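(* Let $N=\{1,\ldots,n\}$, let $X\in\mathbb{R}^{m\times n}$ be an input matrix that is orthonormal, i.e., $X^{\top}X=I$, let $y\in\mathbb{R}^m$ be a vector of outcomes, $\Omega:\mathbb{R}^n\to\mathbb{R}$ a regularizer and $t$ a regularization parameter. Let $\beta^*$ denote the optimal estimator in the problem $$\min_{\beta\in\mathbb{R}^n}\ \|y-X\beta\|_2^2\quad\text{s.t. }\Omega(\beta)\le t. \qquad (\mathrm{R})$$ For a function $\Phi:\mathbb{R}^n\to\mathbb{R}$ consider also the problem $$\min_{\beta\in\mathbb{R}^n}\ \Phi(X^{\top}y-\beta)\quad\text{s.t. }\Omega(\beta)\le t. \qquad (\mathrm{S})$$ Then the following hold: (1) for $\Omega(\beta)=\|\beta\|_1$ or $\Omega(\beta)=\|\beta\|_\infty=\max_{i\in N}|\beta_i|$, $\beta^*$ is also an optimal estimator for problem (S) for any choice of monotonically even continuous Schur-convex function $\Phi$; (2) if $\Omega(\beta)=\|\beta\|_2$, there exist an outcome vector $y\in\mathbb{R}^m$ and a continuous Schur-convex function $\Phi$ that is either non-increasing, non-decreasing, or monotonically even such that $\beta^*$ is not an optimal estimator for problem (S).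
   Context: Schur-convexity: let $x^{\downarrow}$ denote the rearrangement of $x\in\mathbb{R}^n$ in non-increasing order; $x\prec y$ if $\sum_{i=1}^k x^{\downarrow}_i\le\sum_{i=1}^k y^{\downarrow}_i$ for all $k\in N$ and $\sum_{i\in N}x_i=\sum_{i\in N}y_i$. $\Phi:\mathbb{R}^n\to\mathbb{R}$ is Schur-convex if $x\prec y$ implies $\Phi(x)\le\Phi(y)$. Non-increasing/non-decreasing is with respect to the componentwise order. A Schur-convex function $\Phi$ is monotonically even if for every $i\in N$ and $x\in\mathbb{R}^n$: $\Phi$ is unchanged when $x_i$ is replaced by $-x_i$; if $x_i\le 0$ and $\epsilon>0$, replacing $x_i$ by $x_i-\epsilon$ does not decrease $\Phi$; and if $x_i\ge0$ and $\epsilon>0$, replacing $x_i$ by $x_i+\epsilon$ does not decrease $\Phi$.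
   Formalization: Part (2) is stated for t > 0: for t = 0 the only feasible point is 0, so β* = 0 is optimal for (S) for every Φ and the claim fails, and for t < 0 there is no feasible point and no β*. *)

theory Defs
  imports "HOL-Analysis.Analysis" "HOL-Library.Multiset"
begin

text \<open>The entries of \<open>x\<close>, with multiplicity, in non-increasing order; \<open>x\<^sup>\<down>\<^sub>i\<close> in the usual
  1-based notation is \<open>decr_rearrangement x ! (i - 1)\<close>.\<close>

definition decr_rearrangement :: "real ^ 'n \<Rightarrow> real list" where
  "decr_rearrangement x =
     rev (sorted_list_of_multiset (image_mset (\<lambda>i. x $ i) (mset_set UNIV)))"

definition majorized_by :: "real ^ 'n \<Rightarrow> real ^ 'n \<Rightarrow> bool" where
  "majorized_by x y \<longleftrightarrow>
     (\<forall>k\<in>{1..CARD('n)}.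
        (\<Sum>i = 1..k. decr_rearrangement x ! (i - 1))
          \<le> (\<Sum>i = 1..k. decr_rearrangement y ! (i - 1))) \<and>
     (\<Sum>i\<in>UNIV. x $ i) = (\<Sum>i\<in>UNIV. y $ i)"

definition schur_convex :: "(real ^ 'n \<Rightarrow> real) \<Rightarrow> bool" where
  "schur_convex \<Phi> \<longleftrightarrow> (\<forall>x y. majorized_by x y \<longrightarrow> \<Phi> x \<le> \<Phi> y)"

definition replace_coord :: "real ^ 'n \<Rightarrow> 'n \<Rightarrow> real \<Rightarrow> real ^ 'n" where
  "replace_coord x i c = (\<chi> j. if j = i then c else x $ j)"

definition monotonically_even :: "(real ^ 'n \<Rightarrow> real) \<Rightarrow> bool" where
  "monotonically_even \<Phi> \<longleftrightarrow> schur_convex \<Phi> \<and>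
     (\<forall>i x. \<Phi> (replace_coord x i (- (x $ i))) = \<Phi> x \<and>
        (\<forall>\<epsilon>>0. x $ i \<le> 0 \<longrightarrow> \<Phi> x \<le> \<Phi> (replace_coord x i (x $ i - \<epsilon>))) \<and>
        (\<forall>\<epsilon>>0. x $ i \<ge> 0 \<longrightarrow> \<Phi> x \<le> \<Phi> (replace_coord x i (x $ i + \<epsilon>))))"

definition l1_norm :: "real ^ 'n \<Rightarrow> real" where
  "l1_norm \<beta> = (\<Sum>i\<in>UNIV. \<bar>\<beta> $ i\<bar>)"

definition max_norm :: "real ^ 'n \<Rightarrow> real" where
  "max_norm \<beta> = (MAX i\<in>UNIV. \<bar>\<beta> $ i\<bar>)"

text \<open>A matrix with \<open>m\<close> rows and \<open>n\<close> columns has type \<^typ>\<open>real ^ 'n ^ 'm\<close>;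
  \<^const>\<open>norm\<close> on \<^typ>\<open>real ^ 'm\<close> is the Euclidean norm.\<close>

definition optimal_R ::
  "real ^ 'n ^ 'm \<Rightarrow> real ^ 'm \<Rightarrow> (real ^ 'n \<Rightarrow> real) \<Rightarrow> real \<Rightarrow> real ^ 'n \<Rightarrow> bool" where
  "optimal_R X y \<Omega> t = is_arg_min (\<lambda>\<beta>. (norm (y - X *v \<beta>))\<^sup>2) (\<lambda>\<beta>. \<Omega> \<beta> \<le> t)"

definition optimal_S ::
  "(real ^ 'n \<Rightarrow> real) \<Rightarrow> real ^ 'n ^ 'm \<Rightarrow> real ^ 'm \<Rightarrow> (real ^ 'n \<Rightarrow> real) \<Rightarrow> real \<Rightarrow>
    real ^ 'n \<Rightarrow> bool" where
  "optimal_S \<Phi> X y \<Omega> t = is_arg_min (\<lambda>\<beta>. \<Phi> (transpose X *v y - \<beta>)) (\<lambda>\<beta>. \<Omega> \<beta> \<le> t)"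

end

theory Submission imports Defs begin

text \<open>
  Since \<open>X\<close> is orthonormal, (R) asks for the Euclidean projection of \<open>z = X\<^sup>T y\<close> onto the ball
  \<open>\<Omega> \<beta> \<le> t\<close>.

  For the maximum norm the projection minimises every \<open>\<bar>z\<^sub>i - \<beta>\<^sub>i\<bar>\<close> separately, so monotonicity of
  \<open>\<Phi>\<close> in the absolute values is enough. For the 1-norm, the variational inequality of the projection
  gives soft thresholding, \<open>\<bar>z\<^sub>i - \<beta>\<^sup>*\<^sub>i\<bar> = min \<bar>z\<^sub>i\<bar> \<lambda>\<close>. The residual of any feasible \<open>\<beta>\<close> dominates
  in absolute value a nonnegative vector \<open>d\<close> with \<open>d\<^sub>i \<le> \<bar>z\<^sub>i\<bar>\<close> and the same sum as
  \<open>min \<bar>z\<^sub>i\<bar> \<lambda>\<close>, and among all such vectors the truncation \<open>min \<bar>z\<^sub>i\<bar> \<lambda>\<close> is least in the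
  majorization order.

  For the Euclidean norm take \<open>y = 0\<close>: then \<open>\<beta>\<^sup>* = 0\<close>, which does not minimise the increasing
  Schur-convex function \<open>\<Phi> x = (\<Sum>i. x\<^sub>i)\<close>.
\<close>

section \<open>Decreasing rearrangements and majorization\<close>

lemma mset_decr_rearrangement:
  fixes x :: "real ^ 'n"
  shows "mset (decr_rearrangement x) = image_mset (\<lambda>i. x $ i) (mset_set UNIV)"
  unfolding decr_rearrangement_def by simp

lemma length_decr_rearrangement:
  fixes x :: "real ^ 'n"
  shows "length (decr_rearrangement x) = CARD('n)"
  using arg_cong[OF mset_decr_rearrangement[of x], of size] by simp

lemma decr_rearrangement_antimono:
  fixes x :: "real ^ 'n"
  assumes "i \<le> j" "j < CARD('n)"
  shows "decr_rearrangement x ! j \<le> decr_rearrangement x ! i"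
proof -
  have "sorted (rev (decr_rearrangement x))"
    unfolding decr_rearrangement_def by simp
  then show ?thesis
    using assms by (simp add: sorted_rev_iff_nth_mono length_decr_rearrangement)
qed

lemma sum_decr_rearrangement:
  fixes x :: "real ^ 'n" and f :: "real \<Rightarrow> real"
  shows "(\<Sum>j<CARD('n). f (decr_rearrangement x ! j)) = (\<Sum>i\<in>UNIV. f (x $ i))"
proof -
  have "(\<Sum>i\<in>UNIV. f (x $ i)) = sum_mset (image_mset f (mset (decr_rearrangement x)))"
    by (simp add: mset_decr_rearrangement sum_unfold_sum_mset multiset.map_comp comp_def)
  also have "\<dots> = sum_list (map f (decr_rearrangement x))"
    by (metis mset_map sum_mset_sum_list)
  also have "\<dots> = (\<Sum>j<CARD('n). f (decr_rearrangement x ! j))"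
    by (simp add: sum_list_sum_nth length_decr_rearrangement atLeast0LessThan)
  finally show ?thesis by simp
qed

text \<open>Half of the Hardy--Littlewood--Polya criterion: the sum of the \<open>k\<close> largest entries of \<open>x\<close> is the
  minimum over \<open>c\<close> of \<open>k c + (\<Sum>i. max (x\<^sub>i - c) 0)\<close>, attained when \<open>c\<close> is the \<open>k\<close>-th largest entry.\<close>

lemma majorized_byI:
  fixes x y :: "real ^ 'n"
  assumes sum_eq: "(\<Sum>i\<in>UNIV. x $ i) = (\<Sum>i\<in>UNIV. y $ i)"
    and excess: "\<And>c. (\<Sum>i\<in>UNIV. max (x $ i - c) 0) \<le> (\<Sum>i\<in>UNIV. max (y $ i - c) 0)"
  shows "majorized_by x y"
  unfolding majorized_by_def
proof (intro conjI ballI sum_eq)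
  fix k assume "k \<in> {1..CARD('n)}"
  then have k: "1 \<le> k" "k \<le> CARD('n)" by auto
  let ?n = "CARD('n)" and ?x = "decr_rearrangement x" and ?y = "decr_rearrangement y"
  have shift: "(\<Sum>i = 1..k. f (i - 1)) = (\<Sum>j<k. f j)" for f :: "nat \<Rightarrow> real"
    by (rule sum.reindex_bij_witness[of _ Suc "\<lambda>i. i - 1"]) auto
  define c where "c = ?y ! (k - 1)"
  have "(\<Sum>j<k. ?x ! j) \<le> (\<Sum>j<k. c + max (?x ! j - c) 0)"
    by (intro sum_mono) auto
  also have "\<dots> = k * c + (\<Sum>j<k. max (?x ! j - c) 0)"
    by (simp add: sum.distrib)
  also have "\<dots> \<le> k * c + (\<Sum>j<?n. max (?x ! j - c) 0)"
    using k by (intro add_left_mono sum_mono2) auto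
  also have "\<dots> \<le> k * c + (\<Sum>j<?n. max (?y ! j - c) 0)"
    using excess[of c]
    by (simp add: sum_decr_rearrangement[where f = "\<lambda>u. max (u - c) 0"])
  \<comment> \<open>From index \<open>k\<close> on the entries of \<open>?y\<close> are at most
    \<open>c\<close>, so those terms vanish; before index \<open>k\<close> they are at least
    \<open>c\<close>, which then removes the \<open>max\<close>.\<close>
  also have "(\<Sum>j<?n. max (?y ! j - c) 0) = (\<Sum>j<k. max (?y ! j - c) 0)"
    using k decr_rearrangement_antimono[of "k - 1" _ y]
    by (intro sum.mono_neutral_right) (auto simp: c_def)
  also have "\<dots> = (\<Sum>j<k. ?y ! j - c)"
    using k decr_rearrangement_antimono[of _ "k - 1" y]
    by (intro sum.cong) (auto simp: c_def max_def intro!: antisym)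
  also have "k * c + \<dots> = (\<Sum>j<k. ?y ! j)"
    by (simp add: sum_subtractf)
  finally show "(\<Sum>i = 1..k. ?x ! (i - 1)) \<le> (\<Sum>i = 1..k. ?y ! (i - 1))"
    unfolding shift .
qed

text \<open>For \<open>c \<le> l\<close>, equal sums allow comparing deficits below \<open>c\<close>
  instead of excesses above it: the truncation falls short of \<open>c\<close> only where
  \<open>a\<close> does, and there \<open>d \<le> a\<close> falls short at least as much. For
  \<open>c > l\<close> the truncation has no excess.\<close>

lemma majorized_by_truncation:
  fixes a d :: "real ^ 'n" and l :: real
  assumes le: "\<And>i. d $ i \<le> a $ i"
    and sum_eq: "(\<Sum>i\<in>UNIV. min (a $ i) l) = (\<Sum>i\<in>UNIV. d $ i)"
  shows "majorized_by (\<chi> i. min (a $ i) l) d"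
proof (rule majorized_byI)
  fix c
  show "(\<Sum>i\<in>UNIV. max ((\<chi> i. min (a $ i) l) $ i - c) 0) \<le> (\<Sum>i\<in>UNIV. max (d $ i - c) 0)"
  proof (cases "c \<le> l")
    case True
    have split: "max (u - c) 0 = u - c + max (c - u) 0" for u :: real
      by auto
    have "(\<Sum>i\<in>UNIV. max (c - min (a $ i) l) 0) \<le> (\<Sum>i\<in>UNIV. max (c - d $ i) 0)"
    proof (rule sum_mono)
      fix i show "max (c - min (a $ i) l) 0 \<le> max (c - d $ i) 0"
        using le[of i] True by auto
    qed
    then show ?thesis
      by (simp add: split sum.distrib sum_subtractf sum_eq)
  next
    case False
    then have "max ((\<chi> i. min (a $ i) l) $ i - c) 0 = 0" for i by auto
    then show ?thesis by (simp add: sum_nonneg)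
  qed
qed (simp add: sum_eq)

section \<open>Monotonically even functions\<close>

text \<open>After a sign flip of \<open>c\<close> if necessary, the coordinate only moves away from
  0 on its own side.\<close>

lemma monotonically_even_replace_coord_le:
  assumes ev: "monotonically_even \<Phi>" and c: "\<bar>x $ i\<bar> \<le> \<bar>c\<bar>"
  shows "\<Phi> x \<le> \<Phi> (replace_coord x i c)"
proof -
  have flip: "\<Phi> (replace_coord x i (- c)) = \<Phi> (replace_coord x i c)"
  proof -
    have "\<Phi> (replace_coord (replace_coord x i c) i (- (replace_coord x i c $ i)))
        = \<Phi> (replace_coord x i c)"
      using ev unfolding monotonically_even_def by blast
    moreover have "replace_coord (replace_coord x i c) i (- (replace_coord x i c $ i))
        = replace_coord x i (- c)"
      by (simp add: replace_coord_def vec_eq_iff)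
    ultimately show ?thesis by simp
  qed
  have same: "replace_coord x i (x $ i) = x"
    by (simp add: replace_coord_def vec_eq_iff)
  have up: "\<Phi> x \<le> \<Phi> (replace_coord x i c')" if "0 \<le> x $ i" "x $ i \<le> c'" for c'
  proof (cases "c' = x $ i")
    case False
    then have "\<Phi> x \<le> \<Phi> (replace_coord x i (x $ i + (c' - x $ i)))"
      using that ev unfolding monotonically_even_def by (smt (verit))
    then show ?thesis by simp
  qed (simp add: same)
  have down: "\<Phi> x \<le> \<Phi> (replace_coord x i c')" if "x $ i \<le> 0" "c' \<le> x $ i" for c'
  proof (cases "c' = x $ i")
    case False
    then have "\<Phi> x \<le> \<Phi> (replace_coord x i (x $ i - (x $ i - c')))"
      using that ev unfolding monotonically_even_def by (smt (verit))
    then show ?thesis by simp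
  qed (simp add: same)
  show ?thesis
    using up[of c] up[of "- c"] down[of c] down[of "- c"] flip c by linarith
qed

text \<open>Coordinates are replaced one at a time; \<open>A\<close> holds those already
  replaced.\<close>

lemma monotonically_even_le:
  fixes x y :: "real ^ 'n"
  assumes ev: "monotonically_even \<Phi>" and le: "\<And>i. \<bar>x $ i\<bar> \<le> \<bar>y $ i\<bar>"
  shows "\<Phi> x \<le> \<Phi> y"
proof -
  have "\<Phi> x \<le> \<Phi> (\<chi> i. if i \<in> A then y $ i else x $ i)" if "finite A" for A
    using that
  proof (induction A rule: finite_induct)
    case (insert k A)
    let ?u = "\<chi> i. if i \<in> A then y $ i else x $ i"
    have "?u $ k = x $ k" using insert by simp
    then have "\<Phi> ?u \<le> \<Phi> (replace_coord ?u k (y $ k))"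
      using monotonically_even_replace_coord_le[OF ev] le[of k] by metis
    moreover have "replace_coord ?u k (y $ k) = (\<chi> i. if i \<in> insert k A then y $ i else x $ i)"
      by (auto simp: replace_coord_def vec_eq_iff)
    ultimately show ?case using insert.IH by simp
  qed simp
  from this[of UNIV] show ?thesis by simp
qed

section \<open>Reduction to a Euclidean projection\<close>

text \<open>\<open>X\<close> preserves inner products and has adjoint \<open>transpose X\<close>.
  The last bracket does not depend on \<open>b\<close>, so both squared norms have the same
  minimisers.\<close>

lemma norm_diff_orthonormal:
  fixes X :: "real ^ 'n ^ 'm"
  assumes "transpose X ** X = mat 1"
  shows "(norm (y - X *v b))\<^sup>2
    = (norm (transpose X *v y - b))\<^sup>2 + ((norm y)\<^sup>2 - (norm (transpose X *v y))\<^sup>2)"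
proof -
  have adj: "v \<bullet> (X *v b) = (transpose X *v v) \<bullet> b" for v
    by (simp add: dot_lmul_matrix)
  have "(X *v b) \<bullet> (X *v b) = b \<bullet> b"
    by (simp only: adj matrix_vector_mul_assoc assms matrix_vector_mul_lid)
  moreover have "(X *v b) \<bullet> y = (transpose X *v y) \<bullet> b"
    using adj[of y] by (simp only: inner_commute)
  moreover note adj[of y] inner_commute[of b "transpose X *v y"]
  ultimately show ?thesis
    unfolding power2_norm_eq_inner inner_diff_left inner_diff_right by linarith
qed

lemma optimal_R_iff_projection:
  fixes X :: "real ^ 'n ^ 'm"
  assumes "transpose X ** X = mat 1"
  shows "optimal_R X y \<Omega> t b \<longleftrightarrow> \<Omega> b \<le> t \<and>
    (\<forall>b'. \<Omega> b' \<le> t \<longrightarrow> dist (transpose X *v y) b \<le> dist (transpose X *v y) b')"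
  by (auto simp: optimal_R_def is_arg_min_linorder norm_diff_orthonormal[OF assms] dist_norm)

lemma optimal_S_iff:
  "optimal_S \<Phi> X y \<Omega> t b \<longleftrightarrow> \<Omega> b \<le> t \<and>
    (\<forall>b'. \<Omega> b' \<le> t \<longrightarrow> \<Phi> (transpose X *v y - b) \<le> \<Phi> (transpose X *v y - b'))"
  by (auto simp: optimal_S_def is_arg_min_linorder)

section \<open>The maximum norm\<close>

lemma max_norm_le_iff:
  fixes b :: "real ^ 'n"
  shows "max_norm b \<le> t \<longleftrightarrow> (\<forall>i. \<bar>b $ i\<bar> \<le> t)"
  unfolding max_norm_def by simp

text \<open>The ball is a box, so exchanging one coordinate of \<open>b\<close> for that of
  \<open>b'\<close> stays feasible; if it came closer to \<open>z $ i\<close>, \<open>b\<close>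
  would not be nearest.\<close>

lemma max_norm_projection_le:
  fixes b b' z :: "real ^ 'n"
  assumes b: "max_norm b \<le> t" and b': "max_norm b' \<le> t"
    and opt: "\<And>u. max_norm u \<le> t \<Longrightarrow> dist z b \<le> dist z u"
  shows "\<bar>(z - b) $ i\<bar> \<le> \<bar>(z - b') $ i\<bar>"
proof (rule ccontr)
  assume *: "\<not> ?thesis"
  let ?u = "replace_coord b i (b' $ i)"
  have "max_norm ?u \<le> t"
    using b b' by (simp add: max_norm_le_iff replace_coord_def)
  then have "dist z b \<le> dist z ?u" by (rule opt)
  moreover have "(dist z ?u)\<^sup>2 < (dist z b)\<^sup>2"
    unfolding dist_norm power2_norm_eq_inner inner_vec_def
  proof (rule sum_strict_mono_ex1)
    show "\<forall>j\<in>UNIV. (z - ?u) $ j \<bullet> (z - ?u) $ j \<le> (z - b) $ j \<bullet> (z - b) $ j"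
      using * by (auto simp: replace_coord_def abs_le_square_iff simp flip: power2_eq_square)
    show "\<exists>j\<in>UNIV. (z - ?u) $ j \<bullet> (z - ?u) $ j < (z - b) $ j \<bullet> (z - b) $ j"
      using * by (intro bexI[of _ i])
        (auto simp: replace_coord_def abs_le_square_iff simp flip: power2_eq_square)
  qed simp
  ultimately show False
    by (meson not_le power_mono zero_le_dist)
qed

section \<open>The 1-norm\<close>

lemma convex_l1_ball: "convex {b :: real ^ 'n. l1_norm b \<le> t}"
proof (rule convexI)
  fix x y :: "real ^ 'n" and u v :: real
  assume x: "x \<in> {b. l1_norm b \<le> t}" and y: "y \<in> {b. l1_norm b \<le> t}"
    and uv: "0 \<le> u" "0 \<le> v" "u + v = 1"
  have "l1_norm (u *\<^sub>R x + v *\<^sub>R y) \<le> (\<Sum>i\<in>UNIV. u * \<bar>x $ i\<bar> + v * \<bar>y $ i\<bar>)"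
    unfolding l1_norm_def
  proof (rule sum_mono)
    fix i show "\<bar>(u *\<^sub>R x + v *\<^sub>R y) $ i\<bar> \<le> u * \<bar>x $ i\<bar> + v * \<bar>y $ i\<bar>"
      using uv abs_triangle_ineq[of "u * x $ i" "v * y $ i"] by (simp add: abs_mult)
  qed
  also have "\<dots> = u * l1_norm x + v * l1_norm y"
    by (simp add: l1_norm_def sum.distrib sum_distrib_left)
  also have "\<dots> \<le> t"
    using x y uv by (intro convex_bound_le) auto
  finally show "u *\<^sub>R x + v *\<^sub>R y \<in> {b. l1_norm b \<le> t}" by simp
qed

lemma closed_l1_ball: "closed {b :: real ^ 'n. l1_norm b \<le> t}"
  unfolding l1_norm_def by (intro closed_Collect_le continuous_intros)

text \<open>The projection \<open>b\<close> maximises the inner product with its residual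
  \<open>r\<close> over the ball. By duality of the 1-norm and the maximum norm the maximum is
  \<open>t * l\<close>, where \<open>l\<close> is the maximum norm of \<open>r\<close>; the equality
  case of Hoelder forces \<open>r $ i = l * sgn (b $ i)\<close> wherever \<open>b $ i\<close> is
  nonzero.\<close>

lemma l1_projection_soft_threshold:
  fixes b z :: "real ^ 'n"
  assumes b: "l1_norm b \<le> t" and opt: "\<And>u. l1_norm u \<le> t \<Longrightarrow> dist z b \<le> dist z u"
  obtains l where "\<And>i. \<bar>z $ i - b $ i\<bar> = min \<bar>z $ i\<bar> l"
    and "\<And>i. \<bar>z $ i\<bar> = \<bar>z $ i - b $ i\<bar> + \<bar>b $ i\<bar>" and "l = 0 \<or> l > 0 \<and> l1_norm b = t"
proof -
  define r where "r = z - b"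
  have t: "0 \<le> t"
    using b unfolding l1_norm_def by (rule order_trans[rotated]) (simp add: sum_nonneg)
  define l where "l = (MAX i\<in>UNIV. \<bar>r $ i\<bar>)"
  have l_ge: "\<bar>r $ i\<bar> \<le> l" for i
    unfolding l_def by (rule Max_ge) auto
  have "l \<in> range (\<lambda>i. \<bar>r $ i\<bar>)"
    unfolding l_def by (rule Max_in) auto
  then obtain k where k: "l = \<bar>r $ k\<bar>" by auto
  have l0: "0 \<le> l" using k by simp
  have var: "r \<bullet> u \<le> r \<bullet> b" if "l1_norm u \<le> t" for u
    using any_closest_point_dot[OF convex_l1_ball closed_l1_ball, of b t u z] b that opt
    by (simp add: r_def inner_diff_right)
  \<comment> \<open>This signed vertex of the ball attains the dual bound
    \<open>t * l\<close>.\<close>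
  have "l1_norm (axis k (t * sgn (r $ k)) :: real ^ 'n) \<le> t"
    using t by (simp add: l1_norm_def axis_def if_distrib[of abs] abs_mult abs_sgn_eq cong: if_cong)
  from var[OF this] have "t * l \<le> r \<bullet> b"
    by (simp add: inner_axis k abs_sgn mult_ac)
  moreover have term_le: "r $ i * b $ i \<le> l * \<bar>b $ i\<bar>" for i
    using mult_right_mono[OF l_ge[of i], of "\<bar>b $ i\<bar>"] abs_ge_self[of "r $ i * b $ i"]
    by (simp add: abs_mult)
  moreover have rb: "r \<bullet> b = (\<Sum>i\<in>UNIV. r $ i * b $ i)"
    by (simp add: inner_vec_def)
  moreover have lb: "(\<Sum>i\<in>UNIV. l * \<bar>b $ i\<bar>) = l * l1_norm b"
    by (simp add: l1_norm_def sum_distrib_left)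
  moreover have "l * l1_norm b \<le> t * l"
    using mult_left_mono[OF b l0] by (simp add: mult.commute)
  \<comment> \<open>The chain
    \<open>t * l \<le> r \<bullet> b \<le> l * l1_norm b \<le> t * l\<close> collapses to
    equalities.\<close>
  ultimately have eq: "(\<Sum>i\<in>UNIV. l * \<bar>b $ i\<bar> - r $ i * b $ i) = 0" and tl: "l * l1_norm b = t * l"
    using sum_mono[of UNIV "\<lambda>i. r $ i * b $ i" "\<lambda>i. l * \<bar>b $ i\<bar>"]
    unfolding sum_subtractf by (smt (verit))+
  have term_eq: "r $ i * b $ i = l * \<bar>b $ i\<bar>" for i
    using eq term_le by (subst (asm) sum_nonneg_eq_0_iff) auto
  have z: "z $ i = r $ i + b $ i" for i by (simp add: r_def)
  have cases: "b $ i = 0 \<or> b $ i > 0 \<and> r $ i = l \<or> b $ i < 0 \<and> r $ i = - l" for i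
  proof (cases "b $ i" "0 :: real" rule: linorder_cases)
    case less
    then have "r $ i * b $ i = (- l) * b $ i" using term_eq[of i] by simp
    then show ?thesis using less by (subst (asm) mult_right_cancel) auto
  next
    case greater
    then show ?thesis using term_eq[of i] by simp
  qed simp
  show thesis
  proof
    show "\<bar>z $ i - b $ i\<bar> = min \<bar>z $ i\<bar> l" for i
      using cases[of i] l_ge[of i] l0 unfolding z by auto
    show "\<bar>z $ i\<bar> = \<bar>z $ i - b $ i\<bar> + \<bar>b $ i\<bar>" for i
      using cases[of i] l0 unfolding z by auto
    show "l = 0 \<or> l > 0 \<and> l1_norm b = t"
      using tl l0 by auto
  qed
qed

lemma l1_projection_optimal:
  fixes b z b' :: "real ^ 'n"
  assumes ev: "monotonically_even \<Phi>"
    and b: "l1_norm b \<le> t" and b': "l1_norm b' \<le> t"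
    and opt: "\<And>u. l1_norm u \<le> t \<Longrightarrow> dist z b \<le> dist z u"
  shows "\<Phi> (z - b) \<le> \<Phi> (z - b')"
proof -
  obtain l where thr: "\<And>i. \<bar>z $ i - b $ i\<bar> = min \<bar>z $ i\<bar> l"
    and split: "\<And>i. \<bar>z $ i\<bar> = \<bar>z $ i - b $ i\<bar> + \<bar>b $ i\<bar>"
    and l: "l = 0 \<or> l > 0 \<and> l1_norm b = t"
    using l1_projection_soft_threshold[OF b opt] by metis
  show ?thesis
  proof (cases "l = 0")
    \<comment> \<open>Here the residual of \<open>b\<close> is zero, and the constraint need not be
      active.\<close>
    case True
    have "\<bar>(z - b) $ i\<bar> \<le> \<bar>(z - b') $ i\<bar>" for i
      using thr[of i] True by simp
    then show ?thesis by (rule monotonically_even_le[OF ev])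
  next
    case False
    with l have bt: "l1_norm b = t" and "l > 0" by auto
    define r :: "real ^ 'n" where "r = (\<chi> i. min \<bar>z $ i\<bar> l)"
    define S where "S = (\<Sum>i\<in>UNIV. r $ i)"
    \<comment> \<open>The bound by \<open>\<bar>z $ i - b' $ i\<bar>\<close> serves monotonicity of
      \<open>\<Phi>\<close>, the bound by \<open>\<bar>z $ i\<bar>\<close> serves the truncation
      lemma. Scaling by a factor in [0, 1] keeps both and lowers the sum \<open>M\<close> to
      \<open>S\<close>.\<close>
    define m where "m i = min \<bar>z $ i - b' $ i\<bar> \<bar>z $ i\<bar>" for i
    define M where "M = (\<Sum>i\<in>UNIV. m i)"
    have S0: "0 \<le> S"
      unfolding S_def r_def using \<open>l > 0\<close> by (intro sum_nonneg) simp
    have "S = (\<Sum>i\<in>UNIV. \<bar>z $ i\<bar> - \<bar>b $ i\<bar>)"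
      unfolding S_def by (intro sum.cong refl) (simp add: r_def flip: thr, use split in simp)
    also have "\<dots> = (\<Sum>i\<in>UNIV. \<bar>z $ i\<bar>) - t"
      using bt by (simp add: sum_subtractf l1_norm_def)
    also have "\<dots> \<le> (\<Sum>i\<in>UNIV. \<bar>z $ i\<bar> - \<bar>b' $ i\<bar>)"
      using b' by (simp add: sum_subtractf l1_norm_def)
    also have "\<dots> \<le> M"
      unfolding M_def m_def by (intro sum_mono) auto
    finally have SM: "S \<le> M" .
    \<comment> \<open>If \<open>M = 0\<close> then \<open>S = 0\<close> as well, and the junk value \<open>S / 0 = 0\<close> is the right factor.\<close>
    define s where "s = S / M"
    have s: "0 \<le> s" "s \<le> 1" "s * M = S"
      using S0 SM by (auto simp: s_def divide_simps)
    define d :: "real ^ 'n" where "d = (\<chi> i. s * m i)"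
    have m0: "0 \<le> m i" for i by (simp add: m_def)
    have d: "0 \<le> d $ i" "d $ i \<le> m i" for i
      using s m0[of i] mult_right_mono[of s 1 "m i"] by (simp_all add: d_def)
    have "majorized_by (\<chi> i. min ((\<chi> i. \<bar>z $ i\<bar>) $ i) l) d"
    proof (rule majorized_by_truncation)
      show "d $ i \<le> (\<chi> i. \<bar>z $ i\<bar>) $ i" for i
        using d(2)[of i] by (simp add: m_def)
      have "(\<Sum>i\<in>UNIV. d $ i) = s * M" by (simp add: d_def M_def sum_distrib_left)
      then show "(\<Sum>i\<in>UNIV. min ((\<chi> i. \<bar>z $ i\<bar>) $ i) l) = (\<Sum>i\<in>UNIV. d $ i)"
        using s(3) by (simp add: S_def r_def)
    qed
    then have "majorized_by r d" by (simp add: r_def)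
    have "\<Phi> (z - b) \<le> \<Phi> r"
      using \<open>l > 0\<close> by (intro monotonically_even_le[OF ev]) (simp add: thr r_def)
    also have "\<dots> \<le> \<Phi> d"
      using ev \<open>majorized_by r d\<close> by (auto simp: monotonically_even_def schur_convex_def)
    also have "\<dots> \<le> \<Phi> (z - b')"
    proof (rule monotonically_even_le[OF ev])
      fix i show "\<bar>d $ i\<bar> \<le> \<bar>(z - b') $ i\<bar>"
        using d[of i] by (simp add: m_def)
    qed
    finally show ?thesis .
  qed
qed

theorem theorem10:
  fixes X :: "real ^ 'n ^ 'm" and t :: real
  assumes "transpose X ** X = mat 1"
  shows
    "(\<forall>(y :: real ^ 'm) (\<Omega> :: real ^ 'n \<Rightarrow> real) (\<Phi> :: real ^ 'n \<Rightarrow> real) (\<beta>s :: real ^ 'n).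
        (\<Omega> = l1_norm \<or> \<Omega> = max_norm) \<longrightarrow>
        optimal_R X y \<Omega> t \<beta>s \<longrightarrow>
        continuous_on UNIV \<Phi> \<longrightarrow> schur_convex \<Phi> \<longrightarrow> monotonically_even \<Phi> \<longrightarrow>
        optimal_S \<Phi> X y \<Omega> t \<beta>s) \<and>
     (t > 0 \<longrightarrow>
       (\<exists>(y :: real ^ 'm) (\<Phi> :: real ^ 'n \<Rightarrow> real) (\<beta>s :: real ^ 'n).
          continuous_on UNIV \<Phi> \<and> schur_convex \<Phi> \<and>
          (antimono \<Phi> \<or> mono \<Phi> \<or> monotonically_even \<Phi>) \<and>
          optimal_R X y norm t \<beta>s \<and> \<not> optimal_S \<Phi> X y norm t \<beta>s))"
proof (intro conjI allI impI)
  fix y :: "real ^ 'm" and \<Omega> :: "real ^ 'n \<Rightarrow> real" and \<Phi> :: "real ^ 'n \<Rightarrow> real" and b :: "real ^ 'n"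
  assume \<Omega>: "\<Omega> = l1_norm \<or> \<Omega> = max_norm" and R: "optimal_R X y \<Omega> t b"
    and ev: "monotonically_even \<Phi>"
  let ?z = "transpose X *v y"
  have feas: "\<Omega> b \<le> t" and opt: "\<And>u. \<Omega> u \<le> t \<Longrightarrow> dist ?z b \<le> dist ?z u"
    using R unfolding optimal_R_iff_projection[OF assms] by auto
  have "\<Phi> (?z - b) \<le> \<Phi> (?z - b')" if b': "\<Omega> b' \<le> t" for b'
    using \<Omega>
  proof
    assume "\<Omega> = l1_norm"
    then show ?thesis using l1_projection_optimal[OF ev, of b t b' ?z] feas b' opt by simp
  next
    assume "\<Omega> = max_norm"
    then show ?thesis
      using monotonically_even_le[OF ev max_norm_projection_le[of b t b' ?z]] feas b' opt by simp
  qed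
  with feas show "optimal_S \<Phi> X y \<Omega> t b" unfolding optimal_S_iff by blast
next
  assume t: "t > 0"
  let ?\<Phi> = "\<lambda>x :: real ^ 'n. \<Sum>i\<in>UNIV. x $ i"
  have "continuous_on UNIV ?\<Phi>" by (intro continuous_intros)
  moreover have "schur_convex ?\<Phi>" by (simp add: schur_convex_def majorized_by_def)
  moreover have "mono ?\<Phi>" by (auto simp: mono_def less_eq_vec_def intro: sum_mono)
  moreover have "optimal_R X 0 norm t 0"
    using t by (simp add: optimal_R_iff_projection[OF assms])
  moreover have "\<not> optimal_S ?\<Phi> X 0 norm t 0"
  proof
    assume S: "optimal_S ?\<Phi> X 0 norm t 0"
    \<comment> \<open>Any coordinate works; \<open>undefined\<close> merely picks one. The residual
      \<open>- ?u\<close> has sum \<open>- t < 0\<close>.\<close>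
    let ?u = "axis undefined t :: real ^ 'n"
    have "norm ?u \<le> t" using t by (simp add: norm_eq_sqrt_inner inner_axis_axis)
    with S have "0 \<le> (\<Sum>i\<in>UNIV. - (?u $ i))" unfolding optimal_S_iff by fastforce
    also have "\<dots> = - t" by (simp add: axis_def sum_negf)
    finally show False using t by simp
  qed
  ultimately show "\<exists>(y :: real ^ 'm) (\<Phi> :: real ^ 'n \<Rightarrow> real) (\<beta>s :: real ^ 'n).
      continuous_on UNIV \<Phi> \<and> schur_convex \<Phi> \<and>
      (antimono \<Phi> \<or> mono \<Phi> \<or> monotonically_even \<Phi>) \<and>
      optimal_R X y norm t \<beta>s \<and> \<not> optimal_S \<Phi> X y norm t \<beta>s"
    by blast
qed

end
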